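(* Let $n\ge 3$, $1\le t<n$, and let $c_1,c_2,\ldots,c_t\in[n]$ be distinct integers such that the sequence $(c_1,\ldots,c_t)$ avoids both patterns $3412$ and $3421$. Let $$U=\{c_i: i\in[t]\text{ and there exist } j,k\in[t]\text{ such that } i<j<k\text{ and } c_ic_jc_k\text{ is a }231\text{ pattern}\}$$ and $$V=\{c_i: i\in[t]\text{ and there exists } j\in[t]\text{ such that } i<j\text{ and } c_i<c_j\}.$$ If ($U\ne\emptyset$ and $|[\max U]\setminus\{c_1,\ldots,c_t\}|\ge1$) or ($V\neq\emptyset$ and $|[\max V]\setminus\{c_1,\ldots,c_t\}|\ge2$), then $|S_{n,(c_1,\ldots,c_t)}(3412,3421)|=0$; otherwise, $$|S_{n,(c_1,\ldots,c_t)}(3412,3421)|=\mathbb{S}_{c_{(j)}-c_{(j-1)}-2}\prod_{i=j+1}^{t+1}\mathbb{S}_{c_{(i)}-c_{(i-1)}-1},$$ where $c_{(0)}=0$, $c_{(t+1)}=n+1$, $c_{(1)}<c_{(2)}<\cdots<c_{(t)}$ are the elements of $\{c_1,\ldots,c_t\}$ in increasing order, $j=\min\{i\in[t+1]:c_{(i)}-c_{(i-1)}>1\}$, and $\mathbb{S}_m$ is the $m$th large Schr\"oder number.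
   Context: $[n]=\{1,\ldots,n\}$ and $S_n$ is the set of permutations of $[n]$ written as sequences $(\tau(1),\ldots,\tau(n))$. A sequence of distinct integers $\tau=(\tau(1),\ldots,\tau(m))$ contains $\sigma\in S_k$ as a pattern if there are indices $1\le i_1<\cdots<i_k\le m$ such that for all $1\le a<b\le k$, $\tau(i_a)<\tau(i_b)$ if and only if $\sigma(a)<\sigma(b)$ (then $\tau(i_1)\cdots\tau(i_k)$ is called a $\sigma$ pattern); otherwise $\tau$ avoids $\sigma$. $S_{n,(c_1,\ldots,c_t)}(\sigma_1,\ldots,\sigma_m)$ is the set of $\tau\in S_n$ with $(\tau(1),\ldots,\tau(t))=(c_1,\ldots,c_t)$ that avoid all of $\sigma_1,\ldots,\sigma_m$. The large (big) Schr\"oder number $\mathbb{S}_m$, $m\ge0$, is the number of lattice paths from $(0,0)$ to $(m,m)$ with steps $(1,0),(0,1),(1,1)$ that never go above the line $y=x$; the sequence begins $\mathbb{S}_0=1,\ \mathbb{S}_1=2,\ \mathbb{S}_2=6,\ \mathbb{S}_3=22,\ \mathbb{S}_4=90,\ldots$ (OEIS A006318). *)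

theory Defs
  imports Complex_Main "HOL-Combinatorics.Multiset_Permutations"
begin

text \<open>
  Sequences are lists, so the entry written \<open>\<tau>(i)\<close> on paper is \<open>\<tau> ! (i - 1)\<close>. A permutation of
  \<open>{1..n}\<close> in one-line notation is an element of \<^term>\<open>permutations_of_set {1..n}\<close>.
\<close>

definition is_pattern :: "'a::linorder list \<Rightarrow> nat list \<Rightarrow> bool" where
  "is_pattern xs \<sigma> \<longleftrightarrow> length xs = length \<sigma> \<and>
     (\<forall>a b. a < b \<and> b < length \<sigma> \<longrightarrow> (xs ! a < xs ! b \<longleftrightarrow> \<sigma> ! a < \<sigma> ! b))"

definition contains_pattern :: "'a::linorder list \<Rightarrow> nat list \<Rightarrow> bool" where
  "contains_pattern \<tau> \<sigma> \<longleftrightarrow>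
     (\<exists>f :: nat \<Rightarrow> nat. strict_mono_on {..<length \<sigma>} f \<and> f ` {..<length \<sigma>} \<subseteq> {..<length \<tau>} \<and>
        is_pattern (map (\<lambda>a. \<tau> ! f a) [0..<length \<sigma>]) \<sigma>)"

definition avoids :: "'a::linorder list \<Rightarrow> nat list \<Rightarrow> bool" where
  "avoids \<tau> \<sigma> \<longleftrightarrow> \<not> contains_pattern \<tau> \<sigma>"

definition avoiders_with_prefix :: "nat \<Rightarrow> nat list \<Rightarrow> nat list set \<Rightarrow> nat list set" where
  "avoiders_with_prefix n c \<Sigma> =
     {\<tau> \<in> permutations_of_set {1..n}. take (length c) \<tau> = c \<and> (\<forall>\<sigma>\<in>\<Sigma>. avoids \<tau> \<sigma>)}"

definition starts_231 :: "'a::linorder list \<Rightarrow> 'a set" where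
  "starts_231 c = {c ! i | i. i < length c \<and>
     (\<exists>j k. i < j \<and> j < k \<and> k < length c \<and> is_pattern [c ! i, c ! j, c ! k] [2, 3, 1])}"

definition starts_ascent :: "'a::linorder list \<Rightarrow> 'a set" where
  "starts_ascent c = {c ! i | i. i < length c \<and> (\<exists>j. i < j \<and> j < length c \<and> c ! i < c ! j)}"

text \<open>
  The order statistics \<open>c\<^bsub>(i)\<^esub>\<close> of \<open>c\<close> for \<open>0 \<le> i \<le> length c + 1\<close>, with the sentinels
  \<open>c\<^bsub>(0)\<^esub> = 0\<close> and \<open>c\<^bsub>(length c + 1)\<^esub> = n + 1\<close>.
\<close>

definition ord_entry :: "nat \<Rightarrow> nat list \<Rightarrow> nat \<Rightarrow> nat" where
  "ord_entry n c i = (0 # sort c @ [n + 1]) ! i"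

text \<open>
  A lattice path is its list of steps. Steps are straight segments, so a path never goes above
  the line \<open>y = x\<close> iff none of the lattice points at the ends of its steps lies above it.
\<close>

definition schroeder_paths :: "nat \<Rightarrow> (nat \<times> nat) list set" where
  "schroeder_paths m = {p \<in> lists {(1, 0), (0, 1), (1, 1)}.
     (\<Sum>s\<leftarrow>p. fst s) = m \<and> (\<Sum>s\<leftarrow>p. snd s) = m \<and>
     (\<forall>k\<le>length p. (\<Sum>s\<leftarrow>take k p. snd s) \<le> (\<Sum>s\<leftarrow>take k p. fst s))}"

definition schroeder :: "nat \<Rightarrow> nat" where
  "schroeder m = card (schroeder_paths m)"

lemma finite_schroeder_paths: "finite (schroeder_paths m)"
proof -
  have len: "length p \<le> (\<Sum>s\<leftarrow>p. fst s) + (\<Sum>s\<leftarrow>p. snd s)"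
    if "p \<in> lists {(1, 0), (0, 1), (1, 1)}" for p :: "(nat \<times> nat) list"
    using that
  proof induction
    case (Cons s p)
    have "1 \<le> fst s + snd s"
      using Cons.hyps(1) by fastforce
    with Cons.IH show ?case
      by simp
  qed simp
  have "schroeder_paths m \<subseteq> {p. set p \<subseteq> {(1, 0), (0, 1), (1, 1)} \<and> length p \<le> 2 * m}"
  proof
    fix p assume p: "p \<in> schroeder_paths m"
    then have "p \<in> lists {(1, 0), (0, 1), (1, 1)}" and "(\<Sum>s\<leftarrow>p. fst s) = m" and "(\<Sum>s\<leftarrow>p. snd s) = m"
      unfolding schroeder_paths_def by blast+
    with len[of p] show "p \<in> {p. set p \<subseteq> {(1, 0), (0, 1), (1, 1)} \<and> length p \<le> 2 * m}"
      by (simp add: lists_eq_set)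
  qed
  moreover have "finite {p. set p \<subseteq> {(1, 0), (0, 1), (1, 1 :: nat)} \<and> length (p :: (nat \<times> nat) list) \<le> 2 * m}"
    by (rule finite_lists_length_le) simp
  ultimately show ?thesis
    by (rule finite_subset)
qed

end

theory Submission
  imports Defs
begin

text \<open>
  A sequence of distinct entries avoids 3412 and 3421 iff for each of its entries \<open>a\<close>, the part
  following the first later entry above \<open>a\<close> has at most one entry below \<open>a\<close>. For a prefix \<open>c\<close> and
  a completion \<open>d\<close> this says, besides the avoidance by \<open>c\<close> and \<open>d\<close> separately, that \<open>d\<close> has no
  entry below an element of \<open>U\<close>, at most one below an element of \<open>V\<close>, and satisfies the threshold
  condition for every \<open>a\<close> in \<open>c\<close>. The latter depends only on the set of entries of \<open>c\<close>.

  If \<open>a\<close> is the largest threshold and \<open>d\<close> has an entry below it, then \<open>d\<close> is cut just before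
  either its first entry above \<open>a\<close> or its last entry \<open>y\<close> below \<open>a\<close>, whichever comes first. The
  subsequence of \<open>d\<close> below \<open>a\<close> satisfies the remaining thresholds, and the part after the cut, with
  \<open>y\<close> replaced by \<open>a\<close>, is an arbitrary avoiding sequence. Hence the count splits off one factor per
  gap. Applied to a single threshold, the first entry, the same splitting yields the Schroeder
  recurrence for the number of avoiders.
\<close>

subsection \<open>Lattice paths\<close>

text \<open>Prefixes given by factorizations \<open>p = q @ r\<close>, rather than by their lengths,
  split along \<open>Cons\<close> and append, as the decomposition of paths requires.\<close>

lemma schroeder_paths_alt:
  "schroeder_paths m = {p \<in> lists {(1, 0), (0, 1), (1, 1)}.
     sum_list (map fst p) = m \<and> sum_list (map snd p) = m \<and>
     (\<forall>q r. p = q @ r \<longrightarrow> sum_list (map snd q) \<le> sum_list (map fst q))}"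
proof -
  have "(\<forall>k\<le>length p. sum_list (map snd (take k p)) \<le> sum_list (map fst (take k p))) \<longleftrightarrow>
    (\<forall>q r. p = q @ r \<longrightarrow> sum_list (map snd q) \<le> sum_list (map fst q))" for p :: "(nat \<times> nat) list"
  proof (intro iffI allI impI)
    fix q r
    assume H: "\<forall>k\<le>length p. sum_list (map snd (take k p)) \<le> sum_list (map fst (take k p))" and "p = q @ r"
    then show "sum_list (map snd q) \<le> sum_list (map fst q)"
      using H[rule_format, of "length q"] by simp
  qed (metis append_take_drop_id)
  then show ?thesis
    unfolding schroeder_paths_def by simp
qed

lemma schroeder_paths_prefixD:
  "q @ r \<in> schroeder_paths m \<Longrightarrow> sum_list (map snd q) \<le> sum_list (map fst q)"
  unfolding schroeder_paths_alt by blast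

text \<open>The shortest prefix ending above the diagonal overshoots it by one. Its last step is
  therefore \<open>(0, 1)\<close>, taken from a point on the diagonal, and the steps before it form
  a path that stays weakly below.\<close>

lemma first_descent_below:
  assumes "p \<in> lists {(1, 0), (0, 1), (1, 1)}" "sum_list (map fst p) < sum_list (map snd p)"
  shows "\<exists>q r i. p = q @ (0, 1) # r \<and> q \<in> schroeder_paths i"
proof -
  have "\<exists>q r i. p = q @ (0, 1) # r \<and> q \<in> schroeder_paths i"
    if "p \<in> lists {(1, 0), (0, 1), (1, 1)}"
      "\<exists>q r. p = q @ r \<and> sum_list (map fst q) < sum_list (map snd q)" for p :: "(nat \<times> nat) list"
    using that
  proof (induction p rule: rev_induct)
    case (snoc s p)
    show ?case
    proof (cases "\<exists>q r. p = q @ r \<and> sum_list (map fst q) < sum_list (map snd q)")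
      case True
      with snoc.IH snoc.prems(1) obtain q r i where "p = q @ (0, 1) # r" "q \<in> schroeder_paths i"
        by auto
      then show ?thesis
        by auto
    next
      case False
      have le: "sum_list (map snd q) \<le> sum_list (map fst q)" if "p = q @ r" for q r
      proof (rule ccontr)
        assume "\<not> sum_list (map snd q) \<le> sum_list (map fst q)"
        with that False show False
          by (auto simp del: append_eq_append_conv)
      qed
      obtain q r where qr: "p @ [s] = q @ r" "sum_list (map fst q) < sum_list (map snd q)"
        using snoc.prems(2) by blast
      \<comment> \<open>No proper prefix overshoots, so the overshooting one is all of
        \<open>p @ [s]\<close>.\<close>
      have "r = []"
      proof (rule ccontr)
        assume "r \<noteq> []"
        then have "p = q @ butlast r"
          using qr(1) by (metis butlast_append butlast_snoc)
        with le[of q "butlast r"] qr(2) show False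
          by simp
      qed
      with qr have "fst s + sum_list (map fst p) < snd s + sum_list (map snd p)"
        by (auto simp: add.commute)
      moreover have le': "sum_list (map snd p) \<le> sum_list (map fst p)"
        using le[of p "[]"] by simp
      moreover have "s \<in> {(1, 0), (0, 1), (1, 1)}"
        using snoc.prems(1) by auto
      ultimately have "s = (0, 1)" "sum_list (map snd p) = sum_list (map fst p)"
        by auto
      moreover from this have "p \<in> schroeder_paths (sum_list (map fst p))"
        unfolding schroeder_paths_alt using snoc.prems(1) by (intro CollectI conjI allI impI le) auto
      ultimately show ?thesis
        by blast
    qed
  qed simp
  with assms show ?thesis
    by (metis append_Nil2)
qed

lemma schroeder_paths_0: "schroeder_paths 0 = {[]}"
proof -
  have "p = []" if "p \<in> schroeder_paths 0" for p
    using that by (cases p) (auto simp: schroeder_paths_def)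
  moreover have "[] \<in> schroeder_paths 0"
    by (simp add: schroeder_paths_def)
  ultimately show ?thesis by blast
qed

lemma schroeder_0: "schroeder 0 = 1"
  by (simp add: schroeder_def schroeder_paths_0)

lemma all_prefixes_Cons:
  "(\<forall>q r. x # p = q @ r \<longrightarrow> P q) \<longleftrightarrow> P [] \<and> (\<forall>q r. p = q @ r \<longrightarrow> P (x # q))"
  by (auto simp: Cons_eq_append_conv)

lemma all_prefixes_append:
  "(\<forall>q r. u @ v = q @ r \<longrightarrow> P q) \<longleftrightarrow> (\<forall>q r. u = q @ r \<longrightarrow> P q) \<and> (\<forall>q r. v = q @ r \<longrightarrow> P (u @ q))"
  by (auto simp: append_eq_append_conv2)

lemma Cons_diagonal_in_schroeder_paths_iff:
  "(1, 1) # p \<in> schroeder_paths (Suc m) \<longleftrightarrow> p \<in> schroeder_paths m"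
  unfolding schroeder_paths_alt all_prefixes_Cons mem_Collect_eq by simp

lemma schroeder_path_join:
  assumes "q \<in> schroeder_paths i" "r \<in> schroeder_paths k"
  shows "(1, 0) # q @ (0, 1) # r \<in> schroeder_paths (Suc (i + k))"
  using assms unfolding schroeder_paths_alt all_prefixes_Cons all_prefixes_append mem_Collect_eq
  by (simp add: le_SucI)

text \<open>Without its initial step, and moved to the origin, the path ends one unit above the
  diagonal. The first step crossing the diagonal then marks the first return of the original
  path.\<close>

lemma schroeder_path_split:
  assumes "(1, 0) # p \<in> schroeder_paths (Suc m)"
  obtains q r i where "i \<le> m" "p = q @ (0, 1) # r" "q \<in> schroeder_paths i" "r \<in> schroeder_paths (m - i)"
proof -
  have p: "p \<in> lists {(1, 0), (0, 1), (1, 1)}" "sum_list (map fst p) = m" "sum_list (map snd p) = Suc m"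
    using assms by (auto simp: schroeder_paths_def)
  then obtain q r i where qr: "p = q @ (0, 1) # r" "q \<in> schroeder_paths i"
    using first_descent_below[of p] by auto
  have q: "sum_list (map fst q) = i" "sum_list (map snd q) = i"
    using qr(2) by (auto simp: schroeder_paths_def)
  have "sum_list (map snd u) \<le> sum_list (map fst u)" if "r = u @ v" for u v
  proof -
    \<comment> \<open>Here \<open>q\<close> is balanced and the two extra steps cancel, so the bound
      for this prefix of the whole path is the bound for \<open>u\<close>.\<close>
    have "sum_list (map snd ((1, 0) # q @ (0, 1) # u)) \<le> sum_list (map fst ((1, 0) # q @ (0, 1) # u))"
      by (rule schroeder_paths_prefixD[of _ v "Suc m"]) (use that qr(1) assms in simp)
    with q show ?thesis by simp
  qed
  then have "r \<in> schroeder_paths (m - i)"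
    using p q qr(1) by (auto simp: schroeder_paths_alt)
  moreover have "i \<le> m"
    using p q qr(1) by auto
  ultimately show thesis
    using that qr by blast
qed

text \<open>If \<open>q\<close> were a proper prefix of \<open>q'\<close>, then \<open>q'\<close>
  would have the prefix \<open>q @ [(0, 1)]\<close>, which ends above the diagonal because
  \<open>q\<close> ends on it. The roles are symmetric.\<close>

lemma first_descent_unique:
  assumes "q \<in> schroeder_paths i" "q' \<in> schroeder_paths i'" "q @ (0, 1) # r = q' @ (0, 1) # r'"
  shows "q = q'" "r = r'"
proof -
  have no: False if "q' = q @ (0, 1) # u" "q \<in> schroeder_paths i" "q' \<in> schroeder_paths i'" for q q' u i i'
  proof -
    have "sum_list (map snd (q @ [(0, 1)])) \<le> sum_list (map fst (q @ [(0, 1)]))"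
      by (rule schroeder_paths_prefixD[of _ u i']) (use that(1,3) in simp)
    with that(2) show False
      by (auto simp: schroeder_paths_def)
  qed
  from assms(3) obtain us where
    "q = q' @ us \<and> us @ (0, 1) # r = (0, 1) # r' \<or> q @ us = q' \<and> (0, 1) # r = us @ (0, 1) # r'"
    unfolding append_eq_append_conv2 by blast
  then show "q = q'"
    using no[OF _ assms(2,1)] no[OF _ assms(1,2)] by (cases us) auto
  with assms(3) show "r = r'" by simp
qed

text \<open>First-return decomposition: a path starts diagonally, or it starts with
  \<open>(1, 0)\<close> and consists of a part \<open>q\<close> inside the first arch and a part
  \<open>r\<close> after its return to the diagonal.\<close>

lemma schroeder_Suc:
  "schroeder (Suc m) = schroeder m + (\<Sum>i\<le>m. schroeder i * schroeder (m - i))"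
proof -
  let ?j = "\<lambda>(q, r). (1, 0) # q @ (0, 1) # r :: (nat \<times> nat) list"
  let ?P = "\<lambda>i. schroeder_paths i \<times> schroeder_paths (m - i)"
  have eq: "schroeder_paths (Suc m) = (#) (1, 1) ` schroeder_paths m \<union> ?j ` (\<Union>i\<le>m. ?P i)"
  proof (intro equalityI subsetI)
    fix p assume p: "p \<in> schroeder_paths (Suc m)"
    then obtain s p' where s: "p = s # p'" "s \<in> {(1, 0), (0, 1), (1, 1)}"
      by (cases p) (auto simp: schroeder_paths_def)
    have "s \<noteq> (0, 1)"
    proof
      assume "s = (0, 1)"
      with p s(1) show False
        using schroeder_paths_prefixD[of "[(0, 1)]" p' "Suc m"] by simp
    qed
    with s consider "p = (1, 1) # p'" | "p = (1, 0) # p'" by auto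
    then show "p \<in> (#) (1, 1) ` schroeder_paths m \<union> ?j ` (\<Union>i\<le>m. ?P i)"
    proof cases
      case 1
      with p show ?thesis using Cons_diagonal_in_schroeder_paths_iff by blast
    next
      case 2
      with p obtain q r i where "i \<le> m" "p' = q @ (0, 1) # r" "q \<in> schroeder_paths i" "r \<in> schroeder_paths (m - i)"
        using schroeder_path_split by blast
      with 2 have "p = ?j (q, r)" "(q, r) \<in> (\<Union>i\<le>m. ?P i)"
        by auto
      then show ?thesis by blast
    qed
  next
    fix p assume "p \<in> (#) (1, 1) ` schroeder_paths m \<union> ?j ` (\<Union>i\<le>m. ?P i)"
    then consider p' where "p = (1, 1) # p'" "p' \<in> schroeder_paths m"
      | q r i where "p = (1, 0) # q @ (0, 1) # r" "i \<le> m" "q \<in> schroeder_paths i" "r \<in> schroeder_paths (m - i)"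
      by auto
    then show "p \<in> schroeder_paths (Suc m)"
    proof cases
      case 1
      then show ?thesis
        using Cons_diagonal_in_schroeder_paths_iff by blast
    next
      case 2
      then show ?thesis
        using schroeder_path_join[of q i r "m - i"] by simp
    qed
  qed
  \<comment> \<open>The index \<open>i\<close> is recovered as the total width of the first
    component.\<close>
  have disj: "?P i \<inter> ?P i' = {}" if "i \<noteq> i'" for i i'
    using that by (auto simp: schroeder_paths_def)
  have "inj_on ?j (\<Union>i\<le>m. ?P i)"
  proof (rule inj_onI)
    fix x y assume x: "x \<in> (\<Union>i\<le>m. ?P i)" and y: "y \<in> (\<Union>i\<le>m. ?P i)" and eq: "?j x = ?j y"
    obtain q r q' r' where xy: "x = (q, r)" "y = (q', r')"
      by (meson surj_pair)
    from x y xy obtain i i' where "q \<in> schroeder_paths i" "q' \<in> schroeder_paths i'"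
      by auto
    moreover have "q @ (0, 1) # r = q' @ (0, 1) # r'"
      using eq xy by simp
    ultimately show "x = y"
      using first_descent_unique xy by blast
  qed
  then have "card (?j ` (\<Union>i\<le>m. ?P i)) = card (\<Union>i\<le>m. ?P i)"
    by (rule card_image)
  also have "\<dots> = (\<Sum>i\<le>m. card (?P i))"
    by (rule card_UN_disjoint) (use disj finite_schroeder_paths in auto)
  finally have "card (?j ` (\<Union>i\<le>m. ?P i)) = (\<Sum>i\<le>m. schroeder i * schroeder (m - i))"
    by (simp add: schroeder_def card_cartesian_product)
  moreover have "card ((#) (1, 1) ` schroeder_paths m) = schroeder m"
    by (simp add: schroeder_def card_image)
  moreover have "card (schroeder_paths (Suc m)) =
      card ((#) (1, 1) ` schroeder_paths m) + card (?j ` (\<Union>i\<le>m. ?P i))"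
    unfolding eq by (rule card_Un_disjoint) (use finite_schroeder_paths in auto)
  ultimately show ?thesis
    by (simp add: schroeder_def)
qed

subsection \<open>Avoidance as a threshold condition\<close>

text \<open>The first entry above \<open>a\<close> leaves the longest remainder, so testing it alone
  covers all later ones. For distinct entries, failure means that \<open>a\<close>, put in front,
  plays the 3 of a 3412 or 3421 pattern.\<close>

fun threshold_ok :: "'a::linorder \<Rightarrow> 'a list \<Rightarrow> bool" where
  "threshold_ok a [] \<longleftrightarrow> True"
| "threshold_ok a (x # xs) \<longleftrightarrow> (if a < x then length (filter (\<lambda>y. y < a) xs) \<le> 1 else threshold_ok a xs)"

fun good :: "'a::linorder list \<Rightarrow> bool" where
  "good [] \<longleftrightarrow> True"
| "good (x # xs) \<longleftrightarrow> threshold_ok x xs \<and> good xs"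

text \<open>Nested bounds with the largest index outermost can be unfolded along \<open>Cons\<close>
  by \<open>Ex_less_Suc2\<close>. The index characterizations below have this form for the same
  reason.\<close>

lemma two_le_length_filter_iff:
  "2 \<le> length (filter P xs) \<longleftrightarrow> (\<exists>l<length xs. \<exists>k<l. P (xs ! l) \<and> P (xs ! k))"
proof (induction xs)
  case (Cons x xs)
  have "1 \<le> length (filter P xs) \<longleftrightarrow> (\<exists>l<length xs. P (xs ! l))"
    by (metis One_nat_def Suc_leI filter_empty_conv in_set_conv_nth length_greater_0_conv not_less_eq_eq le0 gr_zeroI)
  with Cons show ?case
    by (auto simp: Ex_less_Suc2)
qed simp

lemma not_threshold_ok_iff:
  "\<not> threshold_ok a xs \<longleftrightarrow> (\<exists>l<length xs. \<exists>k<l. \<exists>j<k. xs ! l < a \<and> xs ! k < a \<and> a < xs ! j)"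
proof (induction xs)
  case (Cons x xs)
  have "\<not> length (filter (\<lambda>y. y < a) xs) \<le> 1 \<longleftrightarrow> (\<exists>l<length xs. \<exists>k<l. xs ! l < a \<and> xs ! k < a)"
    unfolding two_le_length_filter_iff[of "\<lambda>y. y < a" xs, symmetric] by auto
  with Cons show ?case
    by (auto simp: Ex_less_Suc2)
qed simp

lemma not_good_iff:
  "\<not> good xs \<longleftrightarrow>
    (\<exists>l<length xs. \<exists>k<l. \<exists>j<k. \<exists>i<j. xs ! l < xs ! i \<and> xs ! k < xs ! i \<and> xs ! i < xs ! j)"
proof (induction xs)
  case (Cons x xs)
  then show ?case
    using not_threshold_ok_iff[of x xs] by (simp add: Ex_less_Suc2 conj_disj_distribL ex_disj_distrib conj_ac, intro disj_commute)
qed simp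

lemma is_pattern_iff:
  "is_pattern xs \<sigma> \<longleftrightarrow> length xs = length \<sigma> \<and>
     (\<forall>b<length \<sigma>. \<forall>a<b. xs ! a < xs ! b \<longleftrightarrow> \<sigma> ! a < \<sigma> ! b)"
  by (auto simp: is_pattern_def)

lemma contains_pattern_length4_iff:
  assumes "length \<sigma> = 4"
  shows "contains_pattern xs \<sigma> \<longleftrightarrow>
    (\<exists>l<length xs. \<exists>k<l. \<exists>j<k. \<exists>i<j. is_pattern [xs ! i, xs ! j, xs ! k, xs ! l] \<sigma>)"
proof
  assume "contains_pattern xs \<sigma>"
  then obtain f where f: "strict_mono_on {..<length \<sigma>} f"
    "f ` {..<length \<sigma>} \<subseteq> {..<length xs}" "is_pattern (map (\<lambda>a. xs ! f a) [0..<length \<sigma>]) \<sigma>"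
    unfolding contains_pattern_def by blast
  have "f 0 < f 1" "f 1 < f 2" "f 2 < f 3"
    using f(1) assms by (auto simp: strict_mono_on_def)
  moreover have "f 3 < length xs"
    using f(2) assms by (simp add: image_subset_iff)
  moreover have "[0..<4] = [0, 1, 2, 3::nat]"
    by (simp add: upt_rec)
  ultimately show "\<exists>l<length xs. \<exists>k<l. \<exists>j<k. \<exists>i<j. is_pattern [xs ! i, xs ! j, xs ! k, xs ! l] \<sigma>"
    using f(3) assms by (intro exI[of _ "f 3"] exI[of _ "f 2"] exI[of _ "f 1"] exI[of _ "f 0"] conjI) auto
next
  assume "\<exists>l<length xs. \<exists>k<l. \<exists>j<k. \<exists>i<j. is_pattern [xs ! i, xs ! j, xs ! k, xs ! l] \<sigma>"
  then obtain i j k l where ijkl: "i < j" "j < k" "k < l" "l < length xs"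
    "is_pattern [xs ! i, xs ! j, xs ! k, xs ! l] \<sigma>"
    by blast
  have eq: "[0..<4] = [0, 1, 2, 3::nat]" and lt: "{..<4} = {0, 1, 2, 3::nat}"
    by (auto simp: upt_rec)
  show "contains_pattern xs \<sigma>"
    unfolding contains_pattern_def using ijkl assms
    by (intro exI[of _ "\<lambda>a. [i, j, k, l] ! a"] conjI)
      (auto simp: eq lt strict_mono_on_def)
qed

lemma is_pattern_length3_iff:
  "is_pattern [x, y, z] [p, q, r] \<longleftrightarrow>
    (x < y \<longleftrightarrow> p < q) \<and> (x < z \<longleftrightarrow> p < r) \<and> (y < z \<longleftrightarrow> q < r)"
  unfolding is_pattern_iff by (auto simp: All_less_Suc2)

lemma is_pattern_length4_iff:
  "is_pattern [x, y, z, w] [p, q, r, s] \<longleftrightarrow>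
    (x < y \<longleftrightarrow> p < q) \<and> (x < z \<longleftrightarrow> p < r) \<and> (x < w \<longleftrightarrow> p < s) \<and>
    (y < z \<longleftrightarrow> q < r) \<and> (y < w \<longleftrightarrow> q < s) \<and> (z < w \<longleftrightarrow> r < s)"
  unfolding is_pattern_iff by (auto simp: All_less_Suc2)

text \<open>The two patterns differ only in the order of their last two entries, so forbidding both
  makes that order irrelevant.\<close>

lemma good_iff_avoids:
  assumes "distinct xs"
  shows "good xs \<longleftrightarrow> avoids xs [3, 4, 1, 2] \<and> avoids xs [3, 4, 2, 1]"
proof -
  have "is_pattern [xs ! i, xs ! j, xs ! k, xs ! l] [3, 4, 1, 2] \<or>
      is_pattern [xs ! i, xs ! j, xs ! k, xs ! l] [3, 4, 2, 1] \<longleftrightarrow>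
      xs ! l < xs ! i \<and> xs ! k < xs ! i \<and> xs ! i < xs ! j"
    if "i < j" "j < k" "k < l" "l < length xs" for i j k l
  proof -
    have "xs ! k \<noteq> xs ! l" "xs ! i \<noteq> xs ! k" "xs ! i \<noteq> xs ! l"
      using assms that by (auto simp: nth_eq_iff_index_eq)
    then show ?thesis
      by (auto simp: is_pattern_length4_iff)
  qed
  note * = this
  have "contains_pattern xs [3, 4, 1, 2] \<or> contains_pattern xs [3, 4, 2, 1] \<longleftrightarrow>
    (\<exists>l<length xs. \<exists>k<l. \<exists>j<k. \<exists>i<j. is_pattern [xs ! i, xs ! j, xs ! k, xs ! l] [3, 4, 1, 2] \<or>
      is_pattern [xs ! i, xs ! j, xs ! k, xs ! l] [3, 4, 2, 1])"
    by (subst (1 2) contains_pattern_length4_iff) (simp, simp, simp only: ex_disj_distrib conj_disj_distribL)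
  also have "\<dots> \<longleftrightarrow> \<not> good xs"
    unfolding not_good_iff by (intro ex_cong1 conj_cong refl *)
  finally show ?thesis
    by (auto simp: avoids_def)
qed

section \<open>Thresholds and goodness of a prefix with its completion\<close>

lemma threshold_ok_if_few_below: "length (filter (\<lambda>y. y < a) xs) \<le> 1 \<Longrightarrow> threshold_ok a xs"
  by (induction xs) (auto split: if_splits)

lemma filter_less_nonempty_iff: "filter (\<lambda>y. y < a) xs \<noteq> [] \<longleftrightarrow> (\<exists>k<length xs. xs ! k < a)"
  by (metis filter_empty_conv in_set_conv_nth)

text \<open>Once \<open>c\<close> has an entry above \<open>a\<close>, everything after it shares an
  allowance of one entry below \<open>a\<close>; \<open>d\<close> may use it only if
  \<open>c\<close> has not.\<close>

lemma threshold_ok_append_iff: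
  "threshold_ok a (c @ d) \<longleftrightarrow> threshold_ok a c \<and> threshold_ok a d \<and>
     ((\<exists>j<length c. a < c ! j) \<longrightarrow> length (filter (\<lambda>y. y < a) d) \<le> 1) \<and>
     ((\<exists>k<length c. \<exists>j<k. c ! k < a \<and> a < c ! j) \<longrightarrow> length (filter (\<lambda>y. y < a) d) = 0)"
proof (induction c)
  case (Cons x c)
  show ?case
  proof (cases "a < x")
    case True
    \<comment> \<open>Index 0, where \<open>x\<close> stands, can always serve as
      \<open>j\<close>.\<close>
    have h: "(\<exists>k<length (x # c). \<exists>j<k. (x # c) ! k < a \<and> a < (x # c) ! j) \<longleftrightarrow>
        filter (\<lambda>y. y < a) c \<noteq> []"
      using True filter_less_nonempty_iff[of a c] by (auto simp: Ex_less_Suc2)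
    have "\<exists>j<length (x # c). a < (x # c) ! j"
      using True by (auto simp: Ex_less_Suc2)
    then show ?thesis
      unfolding h using True threshold_ok_if_few_below[of a d]
      by (cases "filter (\<lambda>y. y < a) c"; cases "filter (\<lambda>y. y < a) d") auto
  next
    case False
    with Cons show ?thesis
      by (simp add: Ex_less_Suc2)
  qed
qed simp

lemma starts_ascent_eq:
  "starts_ascent c = {v. \<exists>j<length c. \<exists>i<j. v = c ! i \<and> v < c ! j}"
  by (auto simp: starts_ascent_def)

text \<open>This order of the indices lets the set for \<open>x # c\<close> be read off from the one
  for \<open>c\<close>; distinctness makes the comparison of \<open>c ! k\<close> with
  \<open>u\<close> strict.\<close>

lemma starts_231_eq:
  assumes "distinct c"
  shows "starts_231 c = {u. \<exists>k<length c. \<exists>j<k. \<exists>i<j. u = c ! i \<and> c ! k < u \<and> u < c ! j}"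
proof -
  have *: "is_pattern [c ! i, c ! j, c ! k] [2, 3, 1] \<longleftrightarrow> c ! k < c ! i \<and> c ! i < c ! j"
    if "i < j" "j < k" "k < length c" for i j k
    using that assms nth_eq_iff_index_eq[of c i k] by (auto simp: is_pattern_length3_iff)
  show ?thesis
    unfolding starts_231_def
  proof (intro Collect_cong iffI)
    fix u
    assume "\<exists>i. u = c ! i \<and> i < length c \<and>
      (\<exists>j k. i < j \<and> j < k \<and> k < length c \<and> is_pattern [c ! i, c ! j, c ! k] [2, 3, 1])"
    then show "\<exists>k<length c. \<exists>j<k. \<exists>i<j. u = c ! i \<and> c ! k < u \<and> u < c ! j"
      using * by blast
  next
    fix u
    assume "\<exists>k<length c. \<exists>j<k. \<exists>i<j. u = c ! i \<and> c ! k < u \<and> u < c ! j"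
    then obtain i j k where "i < j" "j < k" "k < length c" "u = c ! i" "c ! k < u" "u < c ! j"
      by blast
    moreover from this have "i < length c"
      by linarith
    ultimately show "\<exists>i. u = c ! i \<and> i < length c \<and>
      (\<exists>j k. i < j \<and> j < k \<and> k < length c \<and> is_pattern [c ! i, c ! j, c ! k] [2, 3, 1])"
      using * by blast
  qed
qed

text \<open>For a new first entry \<open>x\<close>, the premises of the two conditional clauses in
  \<open>threshold_ok_append_iff\<close> say exactly that \<open>x\<close> joins
  \<open>starts_ascent\<close> or \<open>starts_231\<close>.\<close>

lemma good_append_iff:
  assumes "distinct c"
  shows "good (c @ d) \<longleftrightarrow> good c \<and> good d \<and> (\<forall>a\<in>set c. threshold_ok a d) \<and>
    (\<forall>u\<in>starts_231 c. length (filter (\<lambda>y. y < u) d) = 0) \<and>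
    (\<forall>v\<in>starts_ascent c. length (filter (\<lambda>y. y < v) d) \<le> 1)"
  using assms
proof (induction c)
  case Nil
  then show ?case
    by (simp add: starts_231_def starts_ascent_def)
next
  case (Cons x c)
  have "starts_ascent (x # c) = {v. v = x \<and> (\<exists>j<length c. x < c ! j)} \<union> starts_ascent c"
    by (auto simp: starts_ascent_eq Ex_less_Suc2)
  moreover have "starts_231 (x # c) =
      {u. u = x \<and> (\<exists>k<length c. \<exists>j<k. c ! k < x \<and> x < c ! j)} \<union> starts_231 c"
    using Cons.prems by (auto simp: starts_231_eq Ex_less_Suc2)
  ultimately show ?case
    using Cons threshold_ok_append_iff[of x c d] by (simp add: ball_Un) blast
qed

section \<open>Relabelling and constrained arrangements\<close>

lemma threshold_ok_map_iff:
  assumes "\<And>x y. x \<in> S \<Longrightarrow> y \<in> S \<Longrightarrow> f x < f y \<longleftrightarrow> x < y" "a \<in> S" "set xs \<subseteq> S"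
  shows "threshold_ok (f a) (map f xs) \<longleftrightarrow> threshold_ok a xs"
  using assms(3)
proof (induction xs)
  case (Cons x xs)
  have "filter (\<lambda>y. f y < f a) xs = filter (\<lambda>y. y < a) xs"
    using Cons.prems assms(1,2) by (intro filter_cong) auto
  with Cons show ?case
    using assms(1,2) by (simp add: filter_map o_def)
qed simp

lemma good_map_iff:
  assumes "\<And>x y. x \<in> S \<Longrightarrow> y \<in> S \<Longrightarrow> f x < f y \<longleftrightarrow> x < y" "set xs \<subseteq> S"
  shows "good (map f xs) \<longleftrightarrow> good xs"
  using assms(2)
proof (induction xs)
  case (Cons x xs)
  then show ?case
    using threshold_ok_map_iff[of S f x xs] assms(1) by simp
qed simp

text \<open>With \<open>A\<close> the entries of a prefix and \<open>R\<close> the values it misses,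
  these lists satisfy every condition on a completion except those coming from \<open>U\<close> and
  \<open>V\<close>.\<close>

definition constrained :: "'a::linorder set \<Rightarrow> 'a set \<Rightarrow> 'a list set" where
  "constrained A R = {xs \<in> permutations_of_set R. good xs \<and> (\<forall>a\<in>A. threshold_ok a xs)}"

lemma finite_constrained: "finite R \<Longrightarrow> finite (constrained A R)"
  by (simp add: constrained_def)

lemma constrained_above:
  assumes "\<And>a x. a \<in> A \<Longrightarrow> x \<in> R \<Longrightarrow> a < x"
  shows "constrained A R = constrained {} R"
proof -
  have "threshold_ok a xs" if "a \<in> A" "xs \<in> permutations_of_set R" for a xs
  proof (rule threshold_ok_if_few_below)
    have "filter (\<lambda>y. y < a) xs = []"
      using assms that by (auto simp: filter_empty_conv permutations_of_set_def dest: less_asym)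
    then show "length (filter (\<lambda>y. y < a) xs) \<le> 1" by simp
  qed
  then show ?thesis
    by (auto simp: constrained_def)
qed

definition num_avoiders :: "nat \<Rightarrow> nat" where
  "num_avoiders m = card (constrained {} {..<m})"

text \<open>Goodness depends only on comparisons, so the increasing enumeration \<open>f\<close> of
  \<open>R\<close> carries the good arrangements of an initial segment to those of
  \<open>R\<close>.\<close>

lemma card_constrained_empty:
  fixes R :: "'a::linorder set"
  assumes "finite R"
  shows "card (constrained {} R) = num_avoiders (card R)"
proof -
  define f where "f i = sorted_list_of_set R ! i" for i
  have less: "f x < f y \<longleftrightarrow> x < y" if "x \<in> {..<card R}" "y \<in> {..<card R}" for x y
  proof -
    have "f x < f y" if "x < y" "y < card R" for x y
      using that sorted_wrt_nth_less[OF strict_sorted_list_of_set[of R]] by (simp add: f_def)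
    with that show ?thesis
      by (metis lessThan_iff less_asym linorder_less_linear)
  qed
  then have inj: "inj_on f {..<card R}"
    by (metis inj_onI linorder_less_linear less_irrefl)
  have "f ` {..<card R} = set (sorted_list_of_set R)"
    by (auto simp: f_def in_set_conv_nth image_iff simp del: set_sorted_list_of_set)
  then have img: "f ` {..<card R} = R"
    using assms by simp
  have "constrained {} R = map f ` constrained {} {..<card R}"
  proof -
    have "good (map f xs) \<longleftrightarrow> good xs" if "xs \<in> permutations_of_set {..<card R}" for xs
      using that good_map_iff[of "{..<card R}" f xs] less by (simp add: permutations_of_set_def)
    moreover have "permutations_of_set R = map f ` permutations_of_set {..<card R}"
      using permutations_of_set_image_inj[OF inj] img by simp
    ultimately show ?thesis
      by (auto simp: constrained_def)
  qed
  moreover have "inj_on (map f) (constrained {} {..<card R})"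
    by (rule inj_on_mapI, rule inj_on_subset[OF inj]) (auto simp: constrained_def permutations_of_set_def)
  ultimately show ?thesis
    by (simp add: num_avoiders_def card_image)
qed

section \<open>Cutting a sequence at a pivot\<close>

context
  fixes a y :: "'a::linorder" and p e :: "'a list"
  assumes below: "\<forall>x\<in>set p. x < a" and one: "filter (\<lambda>x. x < a) e = [y]"
begin

lemma filter_less_pivot: "b \<le> a \<Longrightarrow> filter (\<lambda>x. x < b) e = filter (\<lambda>x. x < b) [y]"
proof -
  assume "b \<le> a"
  then have "filter (\<lambda>x. x < b) e = filter (\<lambda>x. x < b) (filter (\<lambda>x. x < a) e)"
    by (auto intro: filter_cong)
  with one show ?thesis by simp
qed

text \<open>The threshold \<open>b\<close> sees nothing of \<open>e\<close> below it except possibly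
  \<open>y\<close>. If the scan stops inside \<open>q\<close>, the counts agree; if it runs through
  \<open>q\<close>, both sides hold, since at most one entry below \<open>b\<close> remains.\<close>

lemma threshold_ok_pivot: "b \<le> a \<Longrightarrow> set q \<subseteq> set p \<Longrightarrow> threshold_ok b (q @ e) \<longleftrightarrow> threshold_ok b (q @ [y])"
proof (induction q)
  case Nil
  then show ?case
    using filter_less_pivot[of b] by (auto intro!: threshold_ok_if_few_below)
next
  case (Cons x q)
  then show ?case
    using filter_less_pivot[of b] by auto
qed

lemma threshold_ok_pivot_self: "set q \<subseteq> set p \<Longrightarrow> threshold_ok a (q @ e)"
proof (induction q)
  case Nil
  then show ?case
    using one by (auto intro!: threshold_ok_if_few_below)
next
  case (Cons x q)
  then show ?case
    using below by auto
qed

text \<open>Entries of \<open>q\<close> lie below \<open>a\<close>, hence are thresholds covered by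
  \<open>threshold_ok_pivot\<close>; entries of \<open>e\<close> are tested inside \<open>e\<close>
  only.\<close>

lemma good_pivot: "set q \<subseteq> set p \<Longrightarrow> good (q @ e) \<longleftrightarrow> good (q @ [y]) \<and> good e"
proof (induction q)
  case (Cons x q)
  then show ?case
    using below threshold_ok_pivot[of x q] by auto
qed simp

end

lemma threshold_ok_pivotE:
  assumes "threshold_ok a xs" "filter (\<lambda>x. x < a) xs \<noteq> []" "a \<notin> set xs"
  obtains p e y where "xs = p @ e" "\<forall>x\<in>set p. x < a" "filter (\<lambda>x. x < a) e = [y]"
proof -
  have "\<exists>p e y. xs = p @ e \<and> (\<forall>x\<in>set p. x < a) \<and> filter (\<lambda>x. x < a) e = [y]"
    using assms
  proof (induction xs)
    case (Cons x xs)
    show ?case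
    \<comment> \<open>The cut falls here if \<open>x\<close> is the first entry above
      \<open>a\<close>, so that at most one entry below \<open>a\<close> follows, or if
      \<open>x\<close> itself is the last entry below \<open>a\<close>.\<close>
    proof (cases "a < x \<or> filter (\<lambda>x. x < a) xs = []")
      case True
      with Cons.prems have "length (filter (\<lambda>x. x < a) (x # xs)) = 1"
        by (auto split: if_splits simp: le_Suc_eq)
      then obtain y where "filter (\<lambda>x. x < a) (x # xs) = [y]"
        by (metis One_nat_def length_0_conv length_Suc_conv)
      then show ?thesis
        by (intro exI[of _ "[]"] exI[of _ "x # xs"] exI[of _ y]) simp
    next
      case False
      with Cons obtain p e y where "xs = p @ e" "\<forall>x\<in>set p. x < a" "filter (\<lambda>x. x < a) e = [y]"
        by (auto split: if_splits)
      moreover from False Cons.prems have "x < a"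
        by auto
      ultimately show ?thesis
        by (intro exI[of _ "x # p"] exI[of _ e] exI[of _ y]) simp
    qed
  qed simp
  with that show thesis by blast
qed

subsection \<open>Splitting at the largest threshold\<close>

lemma filter_eq_singleton:
  assumes "distinct xs" "a \<in> set xs"
  shows "filter (\<lambda>x. x = a) xs = [a]"
  using assms
proof (induction xs)
  case (Cons x xs)
  then show ?case
    by (cases "x = a") (auto simp: filter_empty_conv)
qed simp

text \<open>The factors come from the bijection \<open>J\<close>. The list \<open>l\<close> holds
  the entries below \<open>a\<close> in their order. Only the last of them stands after the cut, and
  its place there is marked by \<open>a\<close> in \<open>e\<close>; this is why the second factor
  arranges \<open>insert a B\<close>.\<close>

lemma card_constrained_split:
  fixes L B A :: "'a::linorder set"
  assumes fin: "finite L" and ne: "L \<noteq> {}"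
    and L: "\<And>x. x \<in> L \<Longrightarrow> x < a" and B: "\<And>x. x \<in> B \<Longrightarrow> a < x" and A: "\<And>b. b \<in> A \<Longrightarrow> b < a"
  shows "card (constrained (insert a A) (L \<union> B)) =
    card (constrained A L) * card (constrained {} (insert a B))"
proof -
  \<comment> \<open>In the second component, \<open>a\<close> is a placeholder for the last entry of the first.\<close>
  define h where "h l = (\<lambda>x. if x = a then last l else x)" for l :: "'a list"
  define J where "J = (\<lambda>(l, e). butlast l @ map (h l) e)"
  let ?P = "constrained A L \<times> constrained {} (insert a B)"
  have pair: "set l = L" "distinct l" "l \<noteq> []" "last l \<in> L" "set e = insert a B" "distinct e"
      "filter (\<lambda>x. x < a) (map (h l) e) = [last l]" "good (map (h l) e) \<longleftrightarrow> good e"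
      "inj_on (h l) (insert a B)" "butlast l @ [last l] = l" "\<forall>x\<in>set (butlast l). x < a"
      "h l ` insert a B = insert (last l) B"
    if "(l, e) \<in> ?P" for l e
  proof -
    show *: "set l = L" "distinct l" "set e = insert a B" "distinct e"
      using that by (auto simp: constrained_def permutations_of_set_def)
    show ne: "l \<noteq> []"
      using *(1) ne by auto
    then show last: "last l \<in> L"
      using *(1) by auto
    show "butlast l @ [last l] = l"
      using ne by simp
    show "\<forall>x\<in>set (butlast l). x < a"
      using *(1) L by (auto dest: in_set_butlastD)
    \<comment> \<open>Like \<open>a\<close>, the entry \<open>last l\<close> lies below all of
      \<open>B\<close>, so substituting it for \<open>a\<close> preserves every comparison.\<close>
    have mono: "h l x < h l y \<longleftrightarrow> x < y" if "x \<in> insert a B" "y \<in> insert a B" for x y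
      using that L[OF last] B by (auto simp: h_def dest: less_trans less_asym)
    then show "inj_on (h l) (insert a B)"
      by (metis inj_onI linorder_less_linear less_irrefl)
    show "good (map (h l) e) \<longleftrightarrow> good e"
      using good_map_iff[of "insert a B" "h l" e] mono * by blast
    have "filter (\<lambda>x. h l x < a) e = filter (\<lambda>x. x = a) e"
      using *(3) L[OF last] B by (intro filter_cong) (auto simp: h_def dest: less_asym)
    then have "filter (\<lambda>x. h l x < a) e = [a]"
      using * filter_eq_singleton[of e a] by simp
    then show "filter (\<lambda>x. x < a) (map (h l) e) = [last l]"
      by (simp add: filter_map o_def h_def)
    show "h l ` insert a B = insert (last l) B"
      using B by (force simp: h_def)
  qed
  have "J ` ?P = constrained (insert a A) (L \<union> B)"
  proof (intro equalityI subsetI)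
    fix xs assume "xs \<in> J ` ?P"
    then obtain l e where le: "(l, e) \<in> ?P" and xs: "xs = butlast l @ map (h l) e"
      by (auto simp: J_def)
    note p = pair[OF le]
    have l: "good l" "\<And>b. b \<in> A \<Longrightarrow> threshold_ok b l" "good e"
      using le by (auto simp: constrained_def)
    have "good xs"
      unfolding xs using good_pivot[OF p(11,7), of "butlast l"] p l by simp
    moreover have "threshold_ok b xs" if "b \<in> insert a A" for b
      unfolding xs using threshold_ok_pivot[OF p(11,7), of b "butlast l"] threshold_ok_pivot_self[OF p(11,7), of "butlast l"]
        that A p(10) l(2) by (auto dest: less_imp_le)
    moreover have "xs \<in> permutations_of_set (L \<union> B)"
    proof -
      have "distinct (butlast l @ [last l])" "set (butlast l @ [last l]) = L"
        using p(1,2,10) by simp_all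
      then have "set (butlast l) = L - {last l}" "distinct (butlast l)"
        by auto
      moreover have "set (map (h l) e) = insert (last l) B"
        using p(5,12) by simp
      moreover have "distinct (map (h l) e)"
        using p(5,6,9) by (simp add: distinct_map)
      moreover have "L \<inter> B = {}"
        using L B by (auto dest: less_asym)
      ultimately show ?thesis
        unfolding xs using p(4) by (auto simp: permutations_of_set_def)
    qed
    ultimately show "xs \<in> constrained (insert a A) (L \<union> B)"
      by (simp add: constrained_def)
  next
    fix xs assume "xs \<in> constrained (insert a A) (L \<union> B)"
    then have xs: "set xs = L \<union> B" "distinct xs" "good xs" "threshold_ok a xs" "\<And>b. b \<in> A \<Longrightarrow> threshold_ok b xs"
      by (auto simp: constrained_def permutations_of_set_def)
    have "a \<notin> set xs" "filter (\<lambda>x. x < a) xs \<noteq> []"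
      using xs(1) L B ne by (auto simp: filter_empty_conv)
    then obtain q e y where q: "xs = q @ e" "\<forall>x\<in>set q. x < a" "filter (\<lambda>x. x < a) e = [y]"
      using threshold_ok_pivotE[OF xs(4)] by blast
    \<comment> \<open>Since \<open>y\<close> is the only entry of \<open>e\<close> below
      \<open>a\<close>, this is the subsequence of \<open>xs\<close> below \<open>a\<close>; the map
      \<open>g\<close> below undoes the substitution \<open>h l\<close>.\<close>
    define l where "l = q @ [y]"
    define g where "g x = (if x = y then a else x)" for x
    have e: "{x \<in> set e. x < a} = {y}"
      using q(3) by (metis list.set(1,2) set_filter)
    then have y: "y \<in> set e" "y < a"
      by auto
    have e_set: "set e = insert y B"
    proof -
      have "x \<in> set e \<longleftrightarrow> x \<in> B" if "x \<noteq> y" for x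
      proof (cases "x < a")
        case True
        with e that B show ?thesis by (auto dest: less_asym)
      next
        case False
        with q xs(1) L show ?thesis by auto
      qed
      moreover have "y \<notin> B"
        using y(2) B by (auto dest: less_asym)
      ultimately show ?thesis using y(1) by (metis equalityI insert_iff subsetI)
    qed
    have l_set: "set l = L"
    proof -
      have "x \<in> set l \<longleftrightarrow> x \<in> L" for x
      proof (cases "x < a")
        case True
        then have "x \<in> L \<longleftrightarrow> x \<in> set xs"
          using xs(1) B by (auto dest: less_asym)
        then show ?thesis
          using True e q(1) by (auto simp: l_def)
      next
        case False
        then show ?thesis
          using L q(2) y(2) by (auto simp: l_def)
      qed
      then show ?thesis by auto
    qed
    have hg: "map (h l) (map g e) = e"
      using e_set xs(1) q(1) B y(2) \<open>a \<notin> set xs\<close> by (auto simp: h_def g_def l_def intro!: map_idI)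
    have "distinct e" "distinct l"
      using xs(2) q(1) y(1) by (auto simp: l_def)
    moreover from this have "distinct (map g e)"
      using hg by (metis distinct_map)
    moreover have "set (map g e) = insert a B"
      using e_set B y(2) by (force simp: g_def)
    moreover have "good e" "good l"
      using good_pivot[OF q(2,3), of q] q(1) xs(3) by (auto simp: l_def)
    moreover have "threshold_ok b l" if "b \<in> A" for b
      using threshold_ok_pivot[OF q(2,3), of b q] A[OF that] xs(5)[OF that] q(1) by (auto simp: l_def)
    moreover have "good (map g e)"
    proof -
      have "g u < g v \<longleftrightarrow> u < v" if "u \<in> insert y B" "v \<in> insert y B" for u v
        using that y(2) B by (auto simp: g_def dest: less_trans less_asym)
      then show ?thesis
        using good_map_iff[of "insert y B" g e] e_set \<open>good e\<close> by blast
    qed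
    ultimately have "(l, map g e) \<in> ?P"
      using l_set by (simp add: constrained_def permutations_of_set_def)
    moreover have "J (l, map g e) = xs"
      using hg q(1) by (simp add: J_def l_def)
    ultimately show "xs \<in> J ` ?P"
      by (metis image_eqI)
  qed
  moreover have "inj_on J ?P"
  proof (rule inj_onI)
    fix x x' assume x: "x \<in> ?P" and x': "x' \<in> ?P" and eq: "J x = J x'"
    obtain l e l' e' where xx: "x = (l, e)" "x' = (l', e')"
      by (meson surj_pair)
    note p = pair[OF x[unfolded xx]] and p' = pair[OF x'[unfolded xx]]
    \<comment> \<open>Both lists arrange \<open>L\<close>; equal lengths allow the two
      concatenations to be compared part by part.\<close>
    have "length l = length l'"
      using p(1,2) p'(1,2) by (metis distinct_card)
    then have "butlast l = butlast l'" and h: "map (h l) e = map (h l') e'"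
      using eq by (auto simp: xx J_def)
    \<comment> \<open>The last entry is recovered as the only entry below \<open>a\<close> after the
      cut.\<close>
    moreover have "last l = last l'"
      using p(7) p'(7) h by simp
    ultimately have "l = l'"
      using p(10) p'(10) by metis
    moreover have "e = e'"
      using h p(5,9) p'(5) \<open>l = l'\<close> by (metis inj_on_map_eq_map Un_absorb)
    ultimately show "x = x'"
      by (simp add: xx)
  qed
  ultimately show ?thesis
    using card_image[of J ?P] by (simp only: card_cartesian_product)
qed

section \<open>Avoiders are counted by the large Schroeder numbers\<close>

lemma num_avoiders_0: "num_avoiders 0 = 1"
proof -
  have "constrained {} {..<0::nat} = {[]}"
    by (auto simp: constrained_def)
  then show ?thesis
    by (simp add: num_avoiders_def)
qed

text \<open>The avoiders are sorted by their first entry \<open>x\<close>, which is the only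
  threshold for the rest. It is vacuous for \<open>x = 0\<close>; otherwise the rest splits at
  \<open>x\<close>.\<close>

lemma num_avoiders_Suc:
  "num_avoiders (Suc m) = num_avoiders m + (\<Sum>i<m. num_avoiders (Suc i) * num_avoiders (m - i))"
proof -
  let ?W = "\<lambda>x. constrained {x} ({..m} - {x})"
  have "constrained {} {..<Suc m} = (\<Union>x\<le>m. (#) x ` ?W x)"
  proof (intro equalityI subsetI)
    fix xs assume xs: "xs \<in> constrained {} {..<Suc m}"
    then obtain x ys where x: "xs = x # ys"
      by (cases xs) (auto simp: constrained_def permutations_of_set_def)
    have "insert x (set ys) = {..m}" "x \<notin> set ys"
      using xs by (simp_all add: x constrained_def permutations_of_set_def lessThan_Suc_atMost)
    then have "x \<le> m" "set ys = {..m} - {x}"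
      by (blast, blast)
    with xs have "x \<le> m" "ys \<in> ?W x"
      by (simp_all add: x constrained_def permutations_of_set_def)
    with x show "xs \<in> (\<Union>x\<le>m. (#) x ` ?W x)"
      by blast
  next
    fix xs assume "xs \<in> (\<Union>x\<le>m. (#) x ` ?W x)"
    then obtain x ys where "xs = x # ys" "x \<le> m" "ys \<in> ?W x"
      by blast
    moreover from this have "insert x (set ys) = {..m}"
      by (simp add: constrained_def permutations_of_set_def insert_absorb)
    ultimately show "xs \<in> constrained {} {..<Suc m}"
      by (simp add: constrained_def permutations_of_set_def lessThan_Suc_atMost)
  qed
  then have "num_avoiders (Suc m) = card (\<Union>x\<le>m. (#) x ` ?W x)"
    by (simp add: num_avoiders_def)
  also have "\<dots> = (\<Sum>x\<le>m. card ((#) x ` ?W x))"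
    by (rule card_UN_disjoint) (auto simp: finite_constrained)
  also have "\<dots> = (\<Sum>x\<le>m. card (?W x))"
    by (simp add: card_image)
  also have "\<dots> = card (?W 0) + (\<Sum>i<m. card (?W (Suc i)))"
    by (simp add: sum.atMost_shift)
  also have "card (?W 0) = num_avoiders m"
    by (subst constrained_above) (auto simp: card_constrained_empty)
  also have "card (?W (Suc i)) = num_avoiders (Suc i) * num_avoiders (m - i)" if "i < m" for i
  proof -
    have "{..m} - {Suc i} = {..<Suc i} \<union> {Suc i<..m}"
      using that by auto
    then have "card (?W (Suc i)) =
        card (constrained {} {..<Suc i}) * card (constrained {} (insert (Suc i) {Suc i<..m}))"
      using card_constrained_split[of "{..<Suc i}" "Suc i" "{Suc i<..m}" "{}"]
      by (simp add: lessThan_empty_iff)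
    \<comment> \<open>There are \<open>m - Suc i\<close> values above the first entry, and the
      placeholder adds one.\<close>
    moreover have "Suc (m - Suc i) = m - i"
      using that by simp
    ultimately show ?thesis
      by (simp add: card_constrained_empty)
  qed
  then have "(\<Sum>i<m. card (?W (Suc i))) = (\<Sum>i<m. num_avoiders (Suc i) * num_avoiders (m - i))"
    by (intro sum.cong) auto
  finally show ?thesis by simp
qed

text \<open>For \<open>m > 0\<close> all indices in \<open>num_avoiders_Suc\<close> are positive,
  and lowering each of them by one turns it into \<open>schroeder_Suc\<close>.\<close>

lemma num_avoiders_eq_schroeder: "num_avoiders (Suc m) = schroeder m"
proof (induction m rule: less_induct)
  case (less m)
  show ?case
  proof (cases m)
    case 0
    then show ?thesis
      using num_avoiders_Suc[of 0] by (simp add: num_avoiders_0 schroeder_0)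
  next
    case (Suc k)
    have "(\<Sum>i<m. num_avoiders (Suc i) * num_avoiders (m - i)) = (\<Sum>i\<le>k. schroeder i * schroeder (k - i))"
    proof (rule sum.cong)
      fix i assume "i \<in> {..k}"
      then have "m - i = Suc (k - i)" "i < m" "k - i < m"
        using Suc by auto
      then show "num_avoiders (Suc i) * num_avoiders (m - i) = schroeder i * schroeder (k - i)"
        using less.IH by metis
    qed (use Suc in auto)
    then show ?thesis
      using less.IH[of k] Suc num_avoiders_Suc[of m] schroeder_Suc[of k] by simp
  qed
qed

subsection \<open>Completions of a prefix\<close>

text \<open>Used contrapositively: where values are missing, some gap must exceed 1.\<close>

lemma le_add_if_steps_le_1:
  fixes f :: "nat \<Rightarrow> nat"
  assumes "\<And>i. 1 \<le> i \<Longrightarrow> i \<le> k \<Longrightarrow> f i - f (i - 1) \<le> 1"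
  shows "f k \<le> f 0 + k"
  using assms
proof (induction k)
  case (Suc k)
  then have "f k \<le> f 0 + k" "f (Suc k) - f k \<le> 1"
    using Suc.prems[of "Suc k"] by auto
  then show ?case by simp
qed simp

text \<open>Splitting off the largest threshold \<open>a\<close> leaves the same problem with
  \<open>a - 1\<close> for \<open>n\<close>. A gap after the \<open>j\<close>-th has
  \<open>gap i - 1\<close> missing values and a placeholder, hence index \<open>gap i - 1\<close>;
  the \<open>j\<close>-th has \<open>gap j - 1\<close> missing values and no placeholder, hence
  index \<open>gap j - 2\<close>.\<close>

lemma card_constrained_eq_prod:
  assumes "sorted_wrt (<) xs" "set xs \<subseteq> {1..n}"
    and "gap = (\<lambda>i. (0 # xs @ [n + 1]) ! i - (0 # xs @ [n + 1]) ! (i - 1))"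
    and "1 \<le> j" "j \<le> length xs + 1" "gap j > 1" "\<And>i. 1 \<le> i \<Longrightarrow> i < j \<Longrightarrow> gap i \<le> 1"
  shows "card (constrained (set xs) ({1..n} - set xs)) =
    schroeder (gap j - 2) * (\<Prod>i = j + 1..length xs + 1. schroeder (gap i - 1))"
  using assms
proof (induction xs arbitrary: n gap rule: rev_induct)
  case Nil
  then have "j = 1" "gap 1 = n + 1" by auto
  moreover from this Nil.prems(6) obtain m where "n = Suc m"
    by (cases n) auto
  ultimately show ?case
    by (simp add: card_constrained_empty num_avoiders_eq_schroeder)
next
  case (snoc a xs)
  let ?e = "\<lambda>n xs i. (0 # xs @ [n + 1]) ! i"
  let ?B = "{a<..n}"
  define L where "L = {1..a - 1} - set xs"
  have xs: "sorted_wrt (<) xs" "\<And>x. x \<in> set xs \<Longrightarrow> x < a" "set xs \<subseteq> {1..n}" "1 \<le> a" "a \<le> n"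
    using snoc.prems(1,2) by (auto simp: sorted_wrt_append)
  then have xs': "set xs \<subseteq> {1..a - 1}"
    by force
  have split: "{1..n} - set (xs @ [a]) = L \<union> ?B"
    unfolding L_def using xs by force
  have fin: "finite L" and L_less: "\<And>x. x \<in> L \<Longrightarrow> x < a"
    using xs(4) by (auto simp: L_def)
  \<comment> \<open>In the smaller instance \<open>a\<close> takes the place of the sentinel
    \<open>n + 1\<close>.\<close>
  have e: "?e n (xs @ [a]) i = ?e (a - 1) xs i" if "i \<le> length xs + 1" for i
    using that xs(4) by (cases i) (auto simp: nth_append)
  have gap: "gap i = ?e (a - 1) xs i - ?e (a - 1) xs (i - 1)" if "1 \<le> i" "i \<le> length xs + 1" for i
    using that e[of i] e[of "i - 1"] by (simp add: snoc.prems(3))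
  have gap_last: "gap (length xs + 2) = n + 1 - a"
    by (simp add: snoc.prems(3) nth_append)
  show ?case
  proof (cases "L = {}")
    case True
    \<comment> \<open>With nothing missing below \<open>a\<close>, the thresholds are 1 up to
      \<open>a\<close>. They are all vacuous, and only the last gap can exceed 1.\<close>
    then have "set xs = {1..<a}"
      unfolding L_def using xs' by force
    then have "xs = [1..<a]"
      using xs(1) by (intro sorted_distinct_set_unique) (simp_all add: strict_sorted_iff)
    then have "?e n (xs @ [a]) i = i" if "i \<le> length xs + 1" for i
      using that xs(4) by (cases i) (auto simp: nth_append)
    then have "gap i \<le> 1" if "i \<le> length xs + 1" for i
      using that by (simp add: snoc.prems(3))
    then have j: "j = length xs + 2"
      using snoc.prems(5,6) by (metis add_2_eq_Suc' add_Suc_right add.right_neutral le_SucE length_append_singleton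
          One_nat_def Suc_eq_plus1 not_le)
    then have "a < n"
      using gap_last snoc.prems(6) xs by simp
    have "constrained (set (xs @ [a])) ({1..n} - set (xs @ [a])) = constrained {} ?B"
      unfolding split True using xs(2) by (subst constrained_above) (auto dest: less_trans)
    moreover have "card ?B = Suc (n + 1 - a - 2)"
      using \<open>a < n\<close> by simp
    ultimately show ?thesis
      using j gap_last by (simp add: card_constrained_empty num_avoiders_eq_schroeder)
  next
    case False
    have "length xs = card (set xs)"
      using xs(1) by (simp add: distinct_card strict_sorted_iff)
    also have "\<dots> < card {1..a - 1}"
      using False xs' by (intro psubset_card_mono) (auto simp: L_def)
    finally have len: "length xs + 1 < a" by simp
    \<comment> \<open>A value missing below \<open>a\<close> forces a gap exceeding 1 before the
      last one, so \<open>j\<close> is also the first such index of the smaller instance.\<close>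
    have j: "j \<le> length xs + 1"
    proof (rule ccontr)
      assume "\<not> j \<le> length xs + 1"
      then have "?e (a - 1) xs (length xs + 1) \<le> ?e (a - 1) xs 0 + (length xs + 1)"
        using snoc.prems(7) gap by (intro le_add_if_steps_le_1) force
      with len show False by (simp add: nth_append)
    qed
    have "card (constrained (set (xs @ [a])) ({1..n} - set (xs @ [a]))) =
        card (constrained (set xs) L) * card (constrained {} (insert a ?B))"
      unfolding split using card_constrained_split[of L a ?B "set xs"] False xs(2) by (simp add: L_less fin)
    also have "card (constrained {} (insert a ?B)) = schroeder (gap (length xs + 2) - 1)"
      unfolding gap_last using xs(5) by (simp add: card_constrained_empty num_avoiders_eq_schroeder)
    also have "card (constrained (set xs) L) =
        schroeder (?e (a - 1) xs j - ?e (a - 1) xs (j - 1) - 2) *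
        (\<Prod>i = j + 1..length xs + 1. schroeder (?e (a - 1) xs i - ?e (a - 1) xs (i - 1) - 1))"
      unfolding L_def using snoc.prems(4,6,7) gap j xs(1) xs'
      by (intro snoc.IH) auto
    also have "\<dots> = schroeder (gap j - 2) * (\<Prod>i = j + 1..length xs + 1. schroeder (gap i - 1))"
      using gap j snoc.prems(4) by simp
    also have "\<dots> * schroeder (gap (length xs + 2) - 1) =
        schroeder (gap j - 2) * (\<Prod>i = j + 1..length (xs @ [a]) + 1. schroeder (gap i - 1))"
      using j by (simp add: prod.nat_ivl_Suc')
    finally show ?thesis .
  qed
qed

text \<open>The entries of a completion below \<open>u\<close> are the missing values below
  \<open>u\<close>, whatever their order. This makes the conditions from \<open>U\<close> and
  \<open>V\<close> depend on the prefix alone.\<close>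

lemma length_filter_less_permutation:
  fixes d :: "nat list"
  assumes "d \<in> permutations_of_set ({1..n} - S)" "u \<in> S" "u \<le> n"
  shows "length (filter (\<lambda>y. y < u) d) = card ({1..u} - S)"
proof -
  have "set d = {1..n} - S"
    using assms(1) by (simp add: permutations_of_set_def)
  moreover have "x < u \<longleftrightarrow> x \<le> u" if "x \<notin> S" for x
    using that assms(2) le_neq_implies_less[of x u] by fastforce
  ultimately have "{x. x < u} \<inter> set d = {1..u} - S"
    using assms(3) by fastforce
  then show ?thesis
    using assms(1) by (simp add: distinct_length_filter permutations_of_set_def)
qed

text \<open>Serves to replace the conditions at \<open>Max U\<close> and \<open>Max V\<close> by
  conditions on all elements of \<open>U\<close> and \<open>V\<close>.\<close>

lemma ex_iff_Max:
  fixes U :: "nat set"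
  assumes "finite U" "\<And>u v. u \<le> v \<Longrightarrow> P u \<Longrightarrow> P v"
  shows "U \<noteq> {} \<and> P (Max U) \<longleftrightarrow> (\<exists>u\<in>U. P u)"
  using assms by (metis Max_ge Max_in empty_iff)

theorem theorem6p5:
  fixes n t :: nat and c :: "nat list"
  assumes "n \<ge> 3" and "1 \<le> t" and "t < n"
    and "length c = t" and "distinct c" and "set c \<subseteq> {1..n}"
    and "avoids c [3, 4, 1, 2]" and "avoids c [3, 4, 2, 1]"
  shows "let U = starts_231 c; V = starts_ascent c;
             j = Min {i \<in> {1..t + 1}. ord_entry n c i - ord_entry n c (i - 1) > 1}
         in card (avoiders_with_prefix n c {[3, 4, 1, 2], [3, 4, 2, 1]}) =
            (if U \<noteq> {} \<and> card ({1..Max U} - set c) \<ge> 1 \<or>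
                V \<noteq> {} \<and> card ({1..Max V} - set c) \<ge> 2
             then 0
             else schroeder (ord_entry n c j - ord_entry n c (j - 1) - 2) *
                  (\<Prod>i = j + 1..t + 1. schroeder (ord_entry n c i - ord_entry n c (i - 1) - 1)))"
proof -
  define U where "U = starts_231 c"
  define V where "V = starts_ascent c"
  define gap where "gap i = ord_entry n c i - ord_entry n c (i - 1)" for i
  define J where "J = {i \<in> {1..t + 1}. gap i > 1}"
  define N where "N u = card ({1..u} - set c)" for u
  define R where "R = {1..n} - set c"
  have UV: "U \<subseteq> set c" "V \<subseteq> set c"
    by (auto simp: U_def V_def starts_231_def starts_ascent_def)
  have N_mono: "N u \<le> N v" if "u \<le> v" for u v
    unfolding N_def using that by (intro card_mono) auto
  have "U \<noteq> {} \<and> 1 \<le> N (Max U) \<longleftrightarrow> (\<exists>u\<in>U. 1 \<le> N u)"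
    using UV(1) N_mono by (intro ex_iff_Max) (auto intro: finite_subset order_trans)
  moreover have "V \<noteq> {} \<and> 2 \<le> N (Max V) \<longleftrightarrow> (\<exists>v\<in>V. 2 \<le> N v)"
    using UV(2) N_mono by (intro ex_iff_Max) (auto intro: finite_subset order_trans)
  ultimately have cond: "(U \<noteq> {} \<and> 1 \<le> N (Max U) \<or> V \<noteq> {} \<and> 2 \<le> N (Max V)) \<longleftrightarrow>
      \<not> ((\<forall>u\<in>U. N u = 0) \<and> (\<forall>v\<in>V. N v \<le> 1))"
    by (auto simp: not_le Suc_le_eq numeral_2_eq_2)
  \<comment> \<open>The last two conditions do not mention \<open>d\<close>: if one of them fails
    there is no completion at all, and otherwise exactly the constrained arrangements
    remain.\<close>
  have good_append: "good (c @ d) \<longleftrightarrow> good d \<and> (\<forall>a\<in>set c. threshold_ok a d) \<and> (\<forall>u\<in>U. N u = 0) \<and> (\<forall>v\<in>V. N v \<le> 1)"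
    if "d \<in> permutations_of_set R" for d
  proof -
    have "length (filter (\<lambda>y. y < u) d) = N u" if "u \<in> set c" for u
      unfolding N_def using \<open>d \<in> _\<close> that assms(6)
      by (intro length_filter_less_permutation[of d n]) (auto simp: R_def)
    moreover have "good c"
      using assms(5,7,8) by (simp add: good_iff_avoids)
    ultimately show ?thesis
      using good_append_iff[OF assms(5), of d] UV
      by (simp add: U_def[symmetric] V_def[symmetric] subset_eq del: length_0_conv)
  qed
  have "avoiders_with_prefix n c {[3, 4, 1, 2], [3, 4, 2, 1]} = (@) c ` {d \<in> permutations_of_set R. good (c @ d)}"
  proof (intro equalityI subsetI)
    fix x assume "x \<in> avoiders_with_prefix n c {[3, 4, 1, 2], [3, 4, 2, 1]}"
    then have x: "set x = {1..n}" "distinct x" "take (length c) x = c" "good x"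
      by (auto simp: avoiders_with_prefix_def permutations_of_set_def good_iff_avoids)
    then obtain d where d: "x = c @ d"
      by (metis append_take_drop_id)
    then have "set d = R"
      using x(1,2) by (auto simp: R_def)
    with d x show "x \<in> (@) c ` {d \<in> permutations_of_set R. good (c @ d)}"
      by (auto simp: permutations_of_set_def)
  next
    fix x assume "x \<in> (@) c ` {d \<in> permutations_of_set R. good (c @ d)}"
    then obtain d where d: "x = c @ d" "set d = R" "distinct d" "good x"
      by (auto simp: permutations_of_set_def)
    then have "set x = {1..n}" "distinct x"
      using assms(5,6) by (auto simp: R_def)
    with d show "x \<in> avoiders_with_prefix n c {[3, 4, 1, 2], [3, 4, 2, 1]}"
      by (simp add: avoiders_with_prefix_def permutations_of_set_def good_iff_avoids)
  qed
  moreover have "inj_on ((@) c) X" for X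
    by (simp add: inj_on_def)
  ultimately have card_eq: "card (avoiders_with_prefix n c {[3, 4, 1, 2], [3, 4, 2, 1]}) =
      card {d \<in> permutations_of_set R. good (c @ d)}"
    by (simp only: card_image)
  have "card (avoiders_with_prefix n c {[3, 4, 1, 2], [3, 4, 2, 1]}) =
    (if U \<noteq> {} \<and> 1 \<le> N (Max U) \<or> V \<noteq> {} \<and> 2 \<le> N (Max V) then 0
     else schroeder (gap (Min J) - 2) * (\<Prod>i = Min J + 1..t + 1. schroeder (gap i - 1)))"
  proof (cases "(\<forall>u\<in>U. N u = 0) \<and> (\<forall>v\<in>V. N v \<le> 1)")
    case False
    then have "{d \<in> permutations_of_set R. good (c @ d)} = {}"
      using good_append by blast
    with False show ?thesis
      unfolding card_eq cond by simp
  next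
    case True
    have sorted: "sorted_wrt (<) (sort c)"
      using assms(5) by (simp add: strict_sorted_iff)
    have gap_eq: "gap = (\<lambda>i. (0 # sort c @ [n + 1]) ! i - (0 # sort c @ [n + 1]) ! (i - 1))"
      by (simp add: gap_def ord_entry_def fun_eq_iff)
    \<comment> \<open>If every gap were at most 1, the last sentinel would give
      \<open>n + 1 \<le> t + 1\<close>, contrary to \<open>t < n\<close>.\<close>
    have "J \<noteq> {}"
    proof
      assume "J = {}"
      then have "ord_entry n c (t + 1) \<le> ord_entry n c 0 + (t + 1)"
        by (intro le_add_if_steps_le_1) (auto simp: J_def gap_def not_less)
      then show False
        using assms(3,4) by (simp add: ord_entry_def nth_append)
    qed
    moreover have "finite J"
      by (simp add: J_def)
    ultimately have j: "Min J \<in> J" "\<And>i. i \<in> J \<Longrightarrow> Min J \<le> i"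
      by simp_all
    have "{d \<in> permutations_of_set R. good (c @ d)} = constrained (set c) R"
      using True good_append by (auto simp: constrained_def)
    moreover have "card (constrained (set (sort c)) ({1..n} - set (sort c))) =
        schroeder (gap (Min J) - 2) * (\<Prod>i = Min J + 1..length (sort c) + 1. schroeder (gap i - 1))"
    proof (rule card_constrained_eq_prod[OF sorted _ gap_eq])
      show "gap i \<le> 1" if "1 \<le> i" "i < Min J" for i
        using that j unfolding J_def
        by (metis (no_types, lifting) atLeastAtMost_iff le_trans less_imp_le mem_Collect_eq not_le)
    qed (use j(1) assms(4,6) in \<open>auto simp: J_def\<close>)
    ultimately show ?thesis
      unfolding card_eq cond using True assms(4) by (simp add: R_def)
  qed
  then show ?thesis
    unfolding Let_def U_def V_def N_def J_def gap_def .
qed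

end
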